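(* Let $m\ge 1$ be an integer, and let $R_{m,3}$ be the maximal positive root of the equation $\Phi_m(r)=0$, where $$\Phi_m (r)= 3r-1 + r^m\left[2r^2(r^m+2)+r^m(1-r)\right].$$ Then for every $f\in\mathcal{B}$ with power series $f(z)=\sum_{k=0}^\infty a_k z^k$, $$|f(z^m)|+|z|\,|f'(z^m)| +\sum_{k=2}^\infty |a_k|r^k \le 1\quad\text{for all } z\in\mathbb{D} \text{ with } |z|=r \le R_{m,3}.$$ Moreover, the constant $R_{m,3}$ cannot be improved, i.e. it cannot be replaced by any larger number: for every $R'\in(R_{m,3},1)$ there exist $f\in\mathcal{B}$ and $z$ with $|z|=r\le R'$ for which the left-hand side is greater than $1$.
   Context: $\mathbb{D}=\{z\in\mathbb{C}: |z|<1\}$, and $\mathcal{B}$ is the set of analytic functions $f$ in $\mathbb{D}$ with $|f(z)|<1$ for all $z\in\mathbb{D}$. *)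

theory Defs
  imports "HOL-Complex_Analysis.Complex_Analysis"
begin

definition unit_disc :: "complex set" ("\<D>") where
  "\<D> = {z. cmod z < 1}"

definition schur_class :: "(complex \<Rightarrow> complex) set" ("\<B>") where
  "\<B> = {f. f holomorphic_on \<D> \<and> (\<forall>z\<in>\<D>. cmod (f z) < 1)}"

definition has_power_series :: "(complex \<Rightarrow> complex) \<Rightarrow> (nat \<Rightarrow> complex) \<Rightarrow> bool" where
  "has_power_series f a \<longleftrightarrow> (\<forall>z\<in>\<D>. (\<lambda>k. a k * z ^ k) sums f z)"

definition \<Phi> :: "nat \<Rightarrow> real \<Rightarrow> real" where
  "\<Phi> m r = 3 * r - 1 + r ^ m * (2 * r ^ 2 * (r ^ m + 2) + r ^ m * (1 - r))"

definition R3 :: "nat \<Rightarrow> real" where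
  "R3 m = (GREATEST r. 0 < r \<and> \<Phi> m r = 0)"

text \<open>The last summand is the tail of the series from index 2 on. It converges for
  \<open>z \<in> \<D>\<close> whenever \<open>a\<close> is the coefficient sequence of a power series converging on \<open>\<D>\<close>,
  so the default value of a divergent \<^const>\<open>suminf\<close> never occurs.\<close>

definition bohr_lhs ::
  "nat \<Rightarrow> (complex \<Rightarrow> complex) \<Rightarrow> (nat \<Rightarrow> complex) \<Rightarrow> complex \<Rightarrow> real" where
  "bohr_lhs m f a z =
     cmod (f (z ^ m)) + cmod z * cmod (deriv f (z ^ m))
       + (\<Sum>k. cmod (a (k + 2)) * cmod z ^ (k + 2))"

lemma bohr_lhs_tail_summable:
  assumes "has_power_series f a" and "z \<in> \<D>"
  shows "summable (\<lambda>k. cmod (a (k + 2)) * cmod z ^ (k + 2))"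
proof -
  obtain t where t: "cmod z < t" "t < 1"
    using assms(2) dense unfolding unit_disc_def by blast
  then have "0 \<le> t" using norm_ge_zero[of z] by linarith
  then have "of_real t \<in> \<D>" using t by (simp add: unit_disc_def)
  then have "summable (\<lambda>k. a k * of_real t ^ k)"
    using assms(1) sums_summable unfolding has_power_series_def by blast
  then have "summable (\<lambda>k. cmod (a k * z ^ k))"
    by (rule powser_insidea) (use t \<open>0 \<le> t\<close> in simp)
  then have "summable (\<lambda>k. cmod (a k) * cmod z ^ k)"
    by (simp add: norm_mult norm_power)
  then show ?thesis by (rule summable_ignore_initial_segment)
qed

text \<open>The maximal positive root exists, so \<open>R3\<close> is well defined.\<close>

lemma R3_root:
  assumes "1 \<le> m"
  shows "0 < R3 m" "\<Phi> m (R3 m) = 0" "R3 m < 1"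
    and R3_maximal: "\<And>s. 0 < s \<Longrightarrow> \<Phi> m s = 0 \<Longrightarrow> s \<le> R3 m"
proof -
  have cont: "continuous_on A (\<Phi> m)" for A
    unfolding \<Phi>_def by (intro continuous_intros)
  have at0: "\<Phi> m 0 = -1" and at1: "\<Phi> m 1 = 8"
    using assms by (simp_all add: \<Phi>_def)
  have pos: "\<Phi> m s > 0" if "1 \<le> s" for s
  proof -
    have "s \<le> s ^ 2" using that by (simp add: self_le_power)
    moreover have "0 \<le> s ^ m * (s ^ 2 * 2 + 1 - s)"
      using that calculation by (intro mult_nonneg_nonneg) auto
    then have "0 \<le> 4 * s ^ 2 + s ^ m * (s ^ 2 * 2 + 1 - s)"
      using that by (simp add: add_nonneg_nonneg)
    then have "0 \<le> s ^ m * (2 * s ^ 2 * (s ^ m + 2) + s ^ m * (1 - s))"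
      using that by (intro mult_nonneg_nonneg) (auto simp: algebra_simps)
    then show ?thesis using that by (simp add: \<Phi>_def)
  qed
  define S where "S = {s \<in> {0..1}. \<Phi> m s = 0}"
  have "compact S"
  proof -
    have "closed S" unfolding S_def
      by (rule continuous_closed_preimage_constant[OF cont]) simp
    moreover have "bounded S" unfolding S_def
      by (rule bounded_subset[of "{0..1}"]) auto
    ultimately show ?thesis by (simp add: compact_eq_bounded_closed)
  qed
  moreover have "S \<noteq> {}"
    using IVT'[of "\<Phi> m" 0 0 1, OF _ _ _ cont] at0 at1 by (auto simp: S_def)
  ultimately obtain r where r: "r \<in> S" "\<forall>s\<in>S. s \<le> r"
    using compact_attains_sup by blast
  have r0: "0 < r" using r(1) at0 by (cases "r = 0") (auto simp: S_def)
  have r1: "r < 1" using r(1) at1 by (cases "r = 1") (auto simp: S_def)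
  have max: "s \<le> r" if "0 < s" "\<Phi> m s = 0" for s
    using pos[of s] r(2) that by (cases "1 \<le> s") (auto simp: S_def)
  have "R3 m = r" unfolding R3_def
    by (rule Greatest_equality) (use r r0 max in \<open>auto simp: S_def\<close>)
  then show "0 < R3 m" "\<Phi> m (R3 m) = 0" "R3 m < 1"
    "\<And>s. 0 < s \<Longrightarrow> \<Phi> m s = 0 \<Longrightarrow> s \<le> R3 m"
    using r r0 r1 max by (auto simp: S_def)
qed

end

theory Submission
  imports Defs
begin

text \<open>
  Write \<open>\<alpha> = |a\<^sub>0|\<close>, \<open>r = |z|\<close> and \<open>\<rho> = r\<^sup>m\<close>. The Schwarz-Pick lemma bounds \<open>|f(z\<^sup>m)|\<close> by
  \<open>(\<alpha> + \<rho>)/(1 + \<alpha>\<rho>)\<close> and \<open>|f'(z\<^sup>m)|\<close> by \<open>(1 - |f(z\<^sup>m)|\<^sup>2)/(1 - \<rho>\<^sup>2)\<close>, and \<open>|a\<^sub>k| \<le> 1 - \<alpha>\<^sup>2\<close> for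
  \<open>k \<ge> 1\<close>. As \<open>r \<le> 1/3\<close>, the sum of the first two terms is increasing in \<open>|f(z\<^sup>m)|\<close>, so the
  left-hand side is at most an explicit function of \<open>\<alpha>\<close>. Its excess over \<open>1\<close> is
  \<open>1 - \<alpha>\<close> times a positive factor times a convex function of \<open>\<alpha>\<close>, which is nonpositive at
  \<open>\<alpha> = 0\<close> and equals \<open>\<Phi> m r\<close> at \<open>\<alpha> = 1\<close>. Since \<open>\<Phi> m\<close> is increasing, this settles \<open>r \<le> R3 m\<close>.
  For \<open>r > R3 m\<close>, the Moebius maps \<open>(\<alpha> + z)/(1 + \<alpha>z)\<close> with \<open>\<alpha>\<close> close to \<open>1\<close> violate the
  inequality at \<open>z = r\<close>.
\<close>

section \<open>Moebius maps and the Schwarz-Pick inequalities\<close>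

lemma unit_disc_eq_ball: "\<D> = ball 0 1"
  by (auto simp: unit_disc_def)

text \<open>The classical formula for 1 - |(z - w)/(1 - cnj w z)|^2, cleared of its denominator. It
  converts the Schwarz estimate for a Moebius image into an inequality between moduli.\<close>

lemma one_minus_norm_Moebius_sq:
  "(1 - cmod w ^ 2) * (1 - cmod z ^ 2) = cmod (1 - cnj w * z) ^ 2 - cmod (z - w) ^ 2"
  unfolding cmod_power2 by (simp add: power2_eq_square algebra_simps)

lemma one_minus_cnj_mult_nonzero:
  assumes "cmod w < 1" "cmod z < 1"
  shows "1 - cnj w * z \<noteq> 0"
proof
  assume "1 - cnj w * z = 0"
  then have "cmod (cnj w * z) = 1" by simp
  moreover have "cmod (cnj w * z) < 1"
    using norm_mult_less[of "cnj w" 1 z 1] assms by simp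
  ultimately show False by simp
qed

lemma Moebius_function_has_field_derivative:
  assumes "1 - cnj w * z \<noteq> 0"
  shows "(Moebius_function 0 w has_field_derivative (1 - cnj w * w) / (1 - cnj w * z) ^ 2) (at z)"
proof -
  have "((\<lambda>z. (z - w) / (1 - cnj w * z)) has_field_derivative
      ((1 - 0) * (1 - cnj w * z) - (z - w) * (0 - cnj w)) / ((1 - cnj w * z) * (1 - cnj w * z))) (at z)"
    using assms
    by (intro DERIV_divide DERIV_diff DERIV_ident DERIV_const DERIV_cmult_Id)
  moreover have "Moebius_function 0 w = (\<lambda>z. (z - w) / (1 - cnj w * z))"
    by (simp add: fun_eq_iff Moebius_function_simple)
  moreover have "(1 - 0) * (1 - cnj w * z) - (z - w) * (0 - cnj w) = 1 - cnj w * w"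
    by (simp add: algebra_simps)
  ultimately show ?thesis by (simp only: power2_eq_square)
qed

text \<open>Composing \<open>f\<close> with the Moebius map that sends \<open>f 0\<close> to 0 makes
  the Schwarz lemma applicable. It controls the pseudo-hyperbolic distance from \<open>f w\<close>
  to \<open>f 0\<close>; the rest of the argument passes from complex values to their
  moduli.\<close>

lemma Schwarz_Pick_growth:
  assumes f: "f \<in> \<B>" and w: "w \<in> \<D>"
  shows "cmod (f w) \<le> (cmod (f 0) + cmod w) / (1 + cmod (f 0) * cmod w)"
proof -
  define b where "b = f 0"
  have f1: "cmod (f z) < 1" if "cmod z < 1" for z
    using f that by (auto simp: schur_class_def unit_disc_def)
  have b1: "cmod b < 1" and w1: "cmod w < 1"
    using f1 w by (auto simp: b_def unit_disc_def)
  define F where "F = Moebius_function 0 b \<circ> f"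
  have "F holomorphic_on ball 0 1"
    unfolding F_def
    by (rule holomorphic_on_compose_gen[OF _ Moebius_function_holomorphic[OF b1]])
       (use f f1 in \<open>auto simp: schur_class_def unit_disc_eq_ball\<close>)
  moreover have "F 0 = 0" by (simp add: F_def b_def Moebius_function_eq_zero)
  moreover have "cmod (F z) < 1" if "cmod z < 1" for z
    using Moebius_function_norm_lt_1[OF b1 f1[OF that]] by (simp add: F_def)
  ultimately have "cmod (F w) \<le> cmod w"
    using Schwarz_Lemma(1)[of F w] w1 by blast
  then have "cmod (f w - b) / cmod (1 - cnj b * f w) \<le> cmod w"
    by (simp add: F_def Moebius_function_simple norm_divide)
  then have le: "cmod (f w - b) \<le> cmod w * cmod (1 - cnj b * f w)"
    using one_minus_cnj_mult_nonzero[OF b1 f1[OF w1]]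
    by (simp add: divide_le_eq)
  define B U \<rho> where "B = cmod b" "U = cmod (f w)" "\<rho> = cmod w"
  note defs = this
  have range: "0 \<le> B" "B < 1" "0 \<le> U" "U < 1" "0 \<le> \<rho>" "\<rho> < 1"
    using b1 w1 f1[OF w1] by (auto simp: defs)
  have BU: "B * U < 1" using range mult_left_mono[of U 1 B] by simp
  define N where "N = cmod (1 - cnj b * f w)"
  have "cmod (f w - b) ^ 2 \<le> \<rho> ^ 2 * N ^ 2"
    using power_mono[OF le, of 2] by (simp add: defs N_def power_mult_distrib)
  then have *: "(1 - \<rho> ^ 2) * N ^ 2 \<le> (1 - B ^ 2) * (1 - U ^ 2)"
    using one_minus_norm_Moebius_sq[of b "f w"]
    by (simp add: defs N_def algebra_simps)
  \<comment> \<open>For given moduli, \<open>N\<close> is smallest when \<open>cnj b * f w\<close>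
    is a nonnegative real; inserting that extreme value leaves only real quantities.\<close>
  have "1 - B * U \<le> N"
    using norm_triangle_ineq2[of 1 "cnj b * f w"] by (simp add: defs N_def norm_mult)
  then have "(1 - B * U) ^ 2 \<le> N ^ 2" using BU by (intro power_mono) auto
  then have "(1 - \<rho> ^ 2) * (1 - B * U) ^ 2 \<le> (1 - \<rho> ^ 2) * N ^ 2"
    using range by (intro mult_left_mono) (auto simp: power_le_one)
  with * have "(1 - \<rho> ^ 2) * (1 - B * U) ^ 2 \<le> (1 - B ^ 2) * (1 - U ^ 2)" by linarith
  \<comment> \<open>The real form of the Moebius identity, (1 - B U)^2 - (1 - B^2)(1 - U^2) = (U -
    B)^2, turns this into a comparison of squares.\<close>
  then have "(U - B) ^ 2 \<le> (\<rho> * (1 - B * U)) ^ 2"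
    by (simp add: power2_eq_square algebra_simps)
  then have "U - B \<le> \<rho> * (1 - B * U)"
    by (rule power2_le_imp_le) (use range BU in auto)
  then have "U * (1 + B * \<rho>) \<le> B + \<rho>" by (simp add: algebra_simps)
  moreover have "0 < 1 + B * \<rho>" using range by (simp add: add_pos_nonneg)
  ultimately show ?thesis
    by (simp add: defs b_def[symmetric] pos_le_divide_eq)
qed

text \<open>Disc automorphisms on both sides move \<open>w\<close> and \<open>f w\<close> to the
  origin, where the Schwarz lemma bounds the derivative by 1. By the chain rule the automorphisms
  contribute the factors 1 - |w|^2 and 1/(1 - |f w|^2).\<close>

lemma Schwarz_Pick_deriv:
  assumes f: "f \<in> \<B>" and w: "w \<in> \<D>"
  shows "cmod (deriv f w) \<le> (1 - cmod (f w) ^ 2) / (1 - cmod w ^ 2)"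
proof -
  define u where "u = f w"
  have hol: "f holomorphic_on ball 0 1" and w1: "cmod w < 1"
    using f w by (auto simp: schur_class_def unit_disc_eq_ball)
  have f1: "cmod (f z) < 1" if "cmod z < 1" for z
    using f that by (auto simp: schur_class_def unit_disc_def)
  have u1: "cmod u < 1" using f1 w1 by (simp add: u_def)
  have w1': "cmod (- w) < 1" using w1 by simp
  define F where "F = Moebius_function 0 u \<circ> (f \<circ> Moebius_function 0 (- w))"
  have "f \<circ> Moebius_function 0 (- w) holomorphic_on ball 0 1"
    by (rule holomorphic_on_compose_gen[OF Moebius_function_holomorphic[OF w1'] hol])
       (use Moebius_function_norm_lt_1[OF w1'] in auto)
  then have "F holomorphic_on ball 0 1"
    unfolding F_def
    by (rule holomorphic_on_compose_gen[OF _ Moebius_function_holomorphic[OF u1]])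
       (use Moebius_function_norm_lt_1[OF w1'] f1 in auto)
  moreover have "F 0 = 0"
    by (simp add: F_def u_def Moebius_function_of_zero Moebius_function_eq_zero)
  moreover have "cmod (F z) < 1" if "cmod z < 1" for z
    using Moebius_function_norm_lt_1[OF u1 f1[OF Moebius_function_norm_lt_1[OF w1' that]]]
    by (simp add: F_def)
  ultimately have le: "cmod (deriv F 0) \<le> 1"
    using Schwarz_Lemma(2)[of F 0] by simp
  have nz: "1 - cnj u * u \<noteq> 0" using one_minus_cnj_mult_nonzero[OF u1 u1] .
  have d1: "(Moebius_function 0 (- w) has_field_derivative (1 - cnj w * w)) (at 0)"
    using Moebius_function_has_field_derivative[of "- w" 0] by simp
  have d2: "(f has_field_derivative deriv f w) (at (Moebius_function 0 (- w) 0))"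
    using holomorphic_derivI[OF hol, of w] w1 by (simp add: Moebius_function_of_zero)
  have "(Moebius_function 0 u has_field_derivative 1 / (1 - cnj u * u)) (at u)"
    using Moebius_function_has_field_derivative[of u u] nz by (simp add: power2_eq_square)
  then have d3: "(Moebius_function 0 u has_field_derivative 1 / (1 - cnj u * u))
      (at ((f \<circ> Moebius_function 0 (- w)) 0))"
    by (simp add: Moebius_function_of_zero u_def)
  have "deriv F 0 = 1 / (1 - cnj u * u) * (deriv f w * (1 - cnj w * w))"
    unfolding F_def by (rule DERIV_imp_deriv[OF DERIV_chain[OF d3 DERIV_chain[OF d2 d1]]])
  moreover have sq: "1 - cnj x * x = of_real (1 - cmod x ^ 2)" for x
    using complex_norm_square[of x] by (simp add: mult.commute)
  have pos: "0 < 1 - cmod x ^ 2" if "cmod x < 1" for x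
    using that by (simp add: power_less_one_iff)
  ultimately have "cmod (deriv F 0)
      = cmod (deriv f w) * (1 - cmod w ^ 2) / (1 - cmod u ^ 2)"
    using pos[OF u1] pos[OF w1]
    by (simp only: sq norm_mult norm_divide norm_of_real abs_of_pos) simp
  with le show ?thesis
    using pos[OF u1] pos[OF w1] by (simp add: u_def field_simps)
qed

section \<open>Taylor coefficients of functions in the class, via averages over roots of
  unity\<close>

lemma has_power_series_at_0:
  assumes "has_power_series f a"
  shows "f 0 = a 0"
proof -
  have "(\<lambda>k. a k * 0 ^ k) sums f 0"
    using assms unfolding has_power_series_def by (rule bspec) (simp add: unit_disc_def)
  then show ?thesis using powser_sums_zero sums_unique2 by blast
qed

lemma has_power_series_deriv_0:
  assumes "has_power_series f a"
  shows "deriv f 0 = a 1"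
proof -
  have sums: "(\<lambda>k. a k * z ^ k) sums f z" if "cmod z < 1" for z
    using assms that by (auto simp: has_power_series_def unit_disc_def)
  have "((\<lambda>z. \<Sum>n. a n * z ^ n) has_field_derivative (\<Sum>n. diffs a n * 0 ^ n)) (at 0)"
    by (rule termdiffs_strong'[where K = 1]) (use sums sums_summable in auto)
  then have "((\<lambda>z. \<Sum>n. a n * z ^ n) has_field_derivative a 1) (at 0)"
    by (simp add: diffs_def)
  then have "(f has_field_derivative a 1) (at 0)"
    by (rule has_field_derivative_transform_within_open[where S = "ball 0 1"])
       (use sums sums_unique in \<open>auto simp: sums_iff\<close>)
  then show ?thesis by (rule DERIV_imp_deriv)
qed

lemma has_power_series_holomorphic:
  assumes "has_power_series f a"
  shows "f holomorphic_on \<D>"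
  unfolding unit_disc_eq_ball
  by (rule power_series_holomorphic[where a = a])
     (use assms in \<open>auto simp: has_power_series_def unit_disc_eq_ball\<close>)

text \<open>The ratio of this geometric sum is a \<open>k\<close>-th root of unity, equal to 1
  exactly when \<open>k\<close> divides \<open>n\<close>. The sum serves as the filter on exponents
  in the averaging below.\<close>

lemma sum_powers_root_unity:
  assumes "0 < k"
  shows "(\<Sum>j<k. (cis (2 * pi / k) ^ n) ^ j) = (if k dvd n then of_nat k else 0)"
proof -
  have root: "cis (2 * pi / k) ^ k = 1" using assms by (subst Complex.DeMoivre) simp
  show ?thesis
  proof (cases "k dvd n")
    case True
    then obtain l where "n = k * l" by auto
    then have "cis (2 * pi / k) ^ n = 1" by (simp add: power_mult root)
    with True show ?thesis by simp
  next
    case False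
    have "cis (2 * pi / k) ^ n = exp (2 * of_real pi * \<i> * of_nat n / of_nat k)"
      by (simp only: Complex.DeMoivre) (simp add: cis_conv_exp mult_ac)
    then have "cis (2 * pi / k) ^ n \<noteq> 1"
      using complex_root_unity_eq_1[of k n] assms False by auto
    moreover have "(cis (2 * pi / k) ^ n) ^ k = 1"
      using root by (metis mult.commute power_mult power_one)
    ultimately show ?thesis using False by (simp add: geometric_sum)
  qed
qed

text \<open>Averaging \<open>f\<close> over the rotations by \<open>k\<close>-th roots of unity keeps exactly the powers
  divisible by \<open>k\<close>.\<close>

lemma schur_class_multisection:
  assumes f: "f \<in> \<B>" and a: "has_power_series f a" and k: "0 < k"
  obtains h where "h \<in> \<B>" "has_power_series h (\<lambda>n. a (k * n))"
proof -
  define h where "h z = (\<Sum>n. a (k * n) * z ^ n)" for z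
  define \<omega> where "\<omega> = cis (2 * pi / k)"
  have *: "(\<lambda>n. a (k * n) * z ^ n) sums h z \<and> cmod (h z) < 1" if z: "cmod z < 1" for z
  proof -
    \<comment> \<open>Averaging \<open>f\<close> over the \<open>k\<close> rotations of a root
      \<open>w\<close> leaves only powers of w^k = z, so the average is \<open>h z\<close>.\<close>
    obtain w where w: "z = w ^ k" using exists_complex_root[of k z] k by blast
    then have "cmod w ^ k < 1" using z norm_power[of w k] by simp
    then have w1: "cmod w < 1" using k by (simp add: power_less_one_iff)
    have rot: "\<omega> ^ j * w \<in> \<D>" for j
      using w1 by (simp add: unit_disc_def norm_mult norm_power \<omega>_def)
    define S where "S = (\<Sum>j<k. f (\<omega> ^ j * w))"
    have "(\<lambda>n. \<Sum>j<k. a n * (\<omega> ^ j * w) ^ n) sums S"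
      unfolding S_def using a rot by (intro sums_sum) (auto simp: has_power_series_def)
    moreover have "(\<Sum>j<k. a n * (\<omega> ^ j * w) ^ n)
        = (if k dvd n then of_nat k * (a n * w ^ n) else 0)" for n
    proof -
      have "(\<Sum>j<k. a n * (\<omega> ^ j * w) ^ n) = a n * w ^ n * (\<Sum>j<k. (\<omega> ^ n) ^ j)"
        by (simp add: sum_distrib_left power_mult_distrib mult_ac flip: power_mult)
      then show ?thesis using sum_powers_root_unity[OF k, of n] by (simp add: \<omega>_def)
    qed
    ultimately have "(\<lambda>n. if k dvd n then of_nat k * (a n * w ^ n) else 0) sums S"
      by simp
    \<comment> \<open>Terms at exponents not divisible by \<open>k\<close> vanish, so the series may
      be reindexed along the multiples of \<open>k\<close>.\<close>
    then have "(\<lambda>n. if k dvd k * n then of_nat k * (a (k * n) * w ^ (k * n)) else 0) sums S"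
      by (subst sums_mono_reindex[where g = "\<lambda>n. k * n"
            and f = "\<lambda>n. if k dvd n then of_nat k * (a n * w ^ n) else 0"])
         (use k in \<open>auto simp: strict_mono_def\<close>)
    then have "(\<lambda>n. of_nat k * (a (k * n) * z ^ n)) sums S"
      by (simp add: power_mult w)
    then have "(\<lambda>n. of_nat k * (a (k * n) * z ^ n) / of_nat k) sums (S / of_nat k)"
      by (rule sums_divide)
    then have sums: "(\<lambda>n. a (k * n) * z ^ n) sums (S / of_nat k)"
      using k by simp
    then have "h z = S / of_nat k" unfolding h_def by (simp add: sums_iff)
    moreover have "cmod S < of_nat k"
    proof -
      have "cmod S \<le> (\<Sum>j<k. cmod (f (\<omega> ^ j * w)))" unfolding S_def by (rule norm_sum)
      also have "\<dots> < (\<Sum>j<k. 1)"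
        using f rot k by (intro sum_strict_mono) (auto simp: schur_class_def)
      finally show ?thesis by simp
    qed
    ultimately show ?thesis using sums k by (simp add: norm_divide)
  qed
  then have ps: "has_power_series h (\<lambda>n. a (k * n))"
    by (simp add: has_power_series_def unit_disc_def)
  moreover have "h \<in> \<B>"
    using * has_power_series_holomorphic[OF ps] by (simp add: schur_class_def unit_disc_def)
  ultimately show thesis by (rule that[rotated])
qed

text \<open>Multisection makes \<open>a k\<close> the linear coefficient of another function of the
  class with the same constant term; Schwarz-Pick at the origin then applies.\<close>

lemma schur_class_coeff_bound:
  assumes "f \<in> \<B>" "has_power_series f a" "0 < k"
  shows "cmod (a k) \<le> 1 - cmod (a 0) ^ 2"
proof -
  obtain h where h: "h \<in> \<B>" "has_power_series h (\<lambda>n. a (k * n))"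
    using schur_class_multisection[OF assms] .
  show ?thesis
    using Schwarz_Pick_deriv[OF h(1), of 0] has_power_series_at_0[OF h(2)]
      has_power_series_deriv_0[OF h(2)]
    by (simp add: unit_disc_def)
qed

section \<open>Real analysis: monotonicity of \<Phi> and the majorant in \<alpha>\<close>

lemma \<Phi>_strict_mono:
  assumes "1 \<le> m" "0 \<le> r" "r < s"
  shows "\<Phi> m r < \<Phi> m s"
proof -
  obtain n where m: "m = Suc n" using assms(1) by (cases m) auto
  \<comment> \<open>The only nonconstant negative term of \<Phi> is -x^(2m+1); it is grouped with
    x^(2m) and 2 x^(2m+2). The factor 1 - x + 2 x^2 alone decreases near 0, but its product with
    x^2, available since m is at least 1, is increasing.\<close>
  define q where "q x = x ^ 2 - x ^ 3 + 2 * x ^ 4" for x :: real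
  have split: "\<Phi> m x = 3 * x - 1 + 4 * x ^ (m + 2) + x ^ (2 * n) * q x" for x
    by (simp add: \<Phi>_def q_def m algebra_simps power_add power_mult power2_eq_square
        power3_eq_cube power4_eq_xxxx)
  have q0: "0 \<le> q r"
  proof -
    have "q r = r ^ 2 * ((1 - r / 2) ^ 2 + 7 / 4 * r ^ 2)"
      by (simp add: q_def power2_eq_square power3_eq_cube power4_eq_xxxx algebra_simps)
    then show ?thesis by simp
  qed
  have "q r \<le> q s"
  proof -
    define x where "x = s + r"
    have x: "0 \<le> x" using assms by (simp add: x_def)
    \<comment> \<open>After division by s - r, the relations s^2 + s r + r^2 = x^2 - s r and 2 (s^2
      + r^2) = x^2 + (s - r)^2 isolate x (1 - x + x^2), whose second factor is a sum of
      squares.\<close>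
    have "q s - q r = (s - r) * (x * ((1 - x / 2) ^ 2 + 3 / 4 * x ^ 2) + s * r + x * (s - r) ^ 2)"
      by (simp add: q_def x_def power2_eq_square power3_eq_cube power4_eq_xxxx field_simps)
    also have "\<dots> \<ge> 0" using assms x by (intro mult_nonneg_nonneg add_nonneg_nonneg) auto
    finally show ?thesis by simp
  qed
  then have "r ^ (2 * n) * q r \<le> s ^ (2 * n) * q s"
    using assms q0 by (intro mult_mono power_mono) auto
  moreover have "r ^ (m + 2) \<le> s ^ (m + 2)" using assms by (intro power_mono) auto
  ultimately show ?thesis using assms by (simp add: split)
qed

text \<open>On [0, 1] everything in \<Phi> besides 3 r - 1 is nonnegative. The value 1/3 serves both
  the monotonicity in |f(z^m)| and the estimate at \<alpha> = 0.\<close>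

lemma \<Phi>_nonpos_imp_le_third:
  assumes "0 \<le> r" "r \<le> 1" "\<Phi> m r \<le> 0"
  shows "r \<le> 1 / 3"
proof -
  have "0 \<le> r ^ m * (2 * r ^ 2 * (r ^ m + 2) + r ^ m * (1 - r))"
    using assms by (intro mult_nonneg_nonneg add_nonneg_nonneg) auto
  then show ?thesis using assms(3) unfolding \<Phi>_def by linarith
qed

lemma Bohr_majorant_le_1:
  fixes a r :: real
  assumes m: "1 \<le> m" and a: "0 \<le> a" "a \<le> 1" and r: "0 \<le> r" "r \<le> 1" and \<Phi>: "\<Phi> m r \<le> 0"
  defines "\<rho> \<equiv> r ^ m"
  shows "(a + \<rho>) / (1 + a * \<rho>) + r * (1 - a ^ 2) / (1 + a * \<rho>) ^ 2
      + (1 - a ^ 2) * r ^ 2 / (1 - r) \<le> 1"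
proof -
  have r3: "r \<le> 1 / 3" using \<Phi>_nonpos_imp_le_third[OF r \<Phi>] .
  have \<rho>: "0 \<le> \<rho>" "\<rho> \<le> r"
    using r m power_decreasing[of 1 m r] by (auto simp: \<rho>_def)
  \<comment> \<open>The excess over 1 with its denominator (1 - r)(1 + t \<rho>)^2 cleared and the
    factor 1 - t divided out.\<close>
  define G where "G t = r * (1 - r) * (1 + t) + r ^ 2 * (1 + t) * (1 + t * \<rho>) ^ 2
      - (1 - r) * (1 - \<rho>) * (1 + t * \<rho>)" for t
  have G1: "G 1 \<le> 0"
    using \<Phi> by (simp add: G_def \<Phi>_def \<rho>_def[symmetric] power2_eq_square algebra_simps)
  have "\<rho> * (1 - r) \<le> r * 1" using \<rho> r by (intro mult_mono) auto
  \<comment> \<open>Here \<open>G 0\<close> is 2 r - 1 + \<rho> (1 - r), which is at most 3 r -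
    1.\<close>
  then have G0: "G 0 \<le> 0"
    using r3 by (simp add: G_def power2_eq_square algebra_simps)
  \<comment> \<open>Convexity as an explicit gap between chord and graph: \<open>G\<close> is a
    cubic whose t^2 and t^3 coefficients are nonnegative, and these contribute multiples of a - a^2
    and a - a^3.\<close>
  have "(1 - a) * G 0 + a * G 1 - G a
      = r ^ 2 * ((2 * \<rho> + \<rho> ^ 2) * (a * (1 - a)) + \<rho> ^ 2 * (a * (1 - a) * (1 + a)))"
    by (simp add: G_def power2_eq_square algebra_simps)
  also have "\<dots> \<ge> 0"
    using a \<rho> by (intro mult_nonneg_nonneg add_nonneg_nonneg) auto
  finally have "G a \<le> (1 - a) * G 0 + a * G 1" by simp
  also have "\<dots> \<le> 0"
    using a G0 G1 by (intro add_nonpos_nonpos mult_nonneg_nonpos) auto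
  finally have Ga: "G a \<le> 0" .
  have pos: "0 < 1 + a * \<rho>" "0 < 1 - r"
    using a \<rho> r3 by (auto simp: add_pos_nonneg)
  define D where "D = 1 + a * \<rho>"
  have "(a + \<rho>) / D + r * (1 - a ^ 2) / D ^ 2 + (1 - a ^ 2) * r ^ 2 / (1 - r) - 1
      = (1 - a) * G a / ((1 - r) * D ^ 2)"
  proof -
    have "(a + \<rho>) * D * (1 - r) / ((1 - r) * D ^ 2) = (a + \<rho>) / D"
      "r * (1 - a ^ 2) * (1 - r) / ((1 - r) * D ^ 2) = r * (1 - a ^ 2) / D ^ 2"
      "(1 - a ^ 2) * r ^ 2 * D ^ 2 / ((1 - r) * D ^ 2) = (1 - a ^ 2) * r ^ 2 / (1 - r)"
      "(1 - r) * D ^ 2 / ((1 - r) * D ^ 2) = 1"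
      using pos by (simp_all add: D_def[symmetric] power2_eq_square)
    moreover have "(1 - a) * G a = (a + \<rho>) * D * (1 - r) + r * (1 - a ^ 2) * (1 - r)
        + (1 - a ^ 2) * r ^ 2 * D ^ 2 - (1 - r) * D ^ 2"
      by (simp add: G_def D_def power2_eq_square algebra_simps)
    ultimately show ?thesis by (simp only: add_divide_distrib diff_divide_distrib)
  qed
  also have "\<dots> \<le> 0"
    using a Ga pos by (intro divide_nonpos_nonneg mult_nonneg_nonpos mult_nonneg_nonneg) auto
  finally show ?thesis by (simp add: D_def)
qed

section \<open>The Bohr-type inequality where \<Phi> is nonpositive\<close>

lemma bohr_lhs_le_1:
  assumes m: "1 \<le> m" and f: "f \<in> \<B>" and ps: "has_power_series f a"
    and z: "z \<in> \<D>" and \<Phi>: "\<Phi> m (cmod z) \<le> 0"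
  shows "bohr_lhs m f a z \<le> 1"
proof -
  define r \<rho> \<alpha> u where "r = cmod z" "\<rho> = r ^ m" "\<alpha> = cmod (a 0)" "u = cmod (f (z ^ m))"
  note defs = this
  have r: "0 \<le> r" "r < 1" using z by (auto simp: defs unit_disc_def)
  have r3: "r \<le> 1 / 3" using \<Phi>_nonpos_imp_le_third[of r m] r \<Phi> by (simp add: defs)
  have \<rho>: "0 \<le> \<rho>" "\<rho> \<le> r" using r m power_decreasing[of 1 m r] by (auto simp: defs)
  have zm: "z ^ m \<in> \<D>" and nzm: "cmod (z ^ m) = \<rho>"
    using \<rho> r by (auto simp: unit_disc_def norm_power defs)
  have f1: "cmod (f x) < 1" if "x \<in> \<D>" for x
    using f that by (auto simp: schur_class_def)
  have \<alpha>: "0 \<le> \<alpha>" "\<alpha> < 1" and u: "0 \<le> u" "u < 1"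
    using f1[of 0] f1[OF zm] has_power_series_at_0[OF ps] by (auto simp: defs unit_disc_def)
  define v where "v = (\<alpha> + \<rho>) / (1 + \<alpha> * \<rho>)"
  have D: "0 < 1 + \<alpha> * \<rho>" using \<alpha> \<rho> by (simp add: add_pos_nonneg)
  have uv: "u \<le> v"
    using Schwarz_Pick_growth[OF f zm] has_power_series_at_0[OF ps] nzm by (simp add: v_def defs)
  have "(1 - \<alpha>) * (1 - \<rho>) \<ge> 0" using \<alpha> \<rho> r by (intro mult_nonneg_nonneg) auto
  then have v1: "v \<le> 1" using D by (simp add: v_def algebra_simps)
  have \<rho>9: "\<rho> ^ 2 \<le> 1 / 9"
    using power_mono[of \<rho> "1 / 3" 2] \<rho> r3 by (simp add: power2_eq_square)
  \<comment> \<open>The weight of 1 - u^2 in the derivative bound. Having \<open>c\<close> at most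
    1/2 is what makes t + c (1 - t^2) nondecreasing on [0, 1].\<close>
  define c where "c = r / (1 - \<rho> ^ 2)"
  have c: "0 \<le> c" "c \<le> 1 / 2"
    using r r3 \<rho>9 by (auto simp: c_def divide_le_eq)
  have "cmod z * cmod (deriv f (z ^ m)) \<le> r * ((1 - u ^ 2) / (1 - \<rho> ^ 2))"
    using Schwarz_Pick_deriv[OF f zm] r nzm unfolding defs by (intro mult_mono) auto
  then have d: "cmod z * cmod (deriv f (z ^ m)) \<le> c * (1 - u ^ 2)" by (simp add: c_def)
  \<comment> \<open>This product is the increment of t + c (1 - t^2) from \<open>u\<close> to
    \<open>v\<close>.\<close>
  have "0 \<le> (v - u) * (1 - c * (u + v))"
  proof (intro mult_nonneg_nonneg)
    have "c * (u + v) \<le> 1 / 2 * (1 + 1)" using c u v1 uv by (intro mult_mono) auto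
    then show "0 \<le> 1 - c * (u + v)" by simp
  qed (use uv in auto)
  then have mono: "u + c * (1 - u ^ 2) \<le> v + c * (1 - v ^ 2)"
    by (simp add: power2_eq_square algebra_simps)
  \<comment> \<open>The factor 1 - \<rho>^2 of 1 - v^2 cancels the denominator of \<open>c\<close>,
    giving the form used in the majorant.\<close>
  have cv: "c * (1 - v ^ 2) = r * (1 - \<alpha> ^ 2) / (1 + \<alpha> * \<rho>) ^ 2"
  proof -
    have "1 - v ^ 2 = ((1 + \<alpha> * \<rho>) ^ 2 - (\<alpha> + \<rho>) ^ 2) / (1 + \<alpha> * \<rho>) ^ 2"
      using D by (simp add: v_def power_divide diff_divide_distrib)
    also have "(1 + \<alpha> * \<rho>) ^ 2 - (\<alpha> + \<rho>) ^ 2 = (1 - \<alpha> ^ 2) * (1 - \<rho> ^ 2)"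
      by (simp add: power2_eq_square algebra_simps)
    finally show ?thesis using \<rho>9 by (simp add: c_def)
  qed
  have geo: "(\<lambda>k. (1 - \<alpha> ^ 2) * r ^ (k + 2)) sums ((1 - \<alpha> ^ 2) * r ^ 2 / (1 - r))"
  proof -
    have "(\<lambda>k. (1 - \<alpha> ^ 2) * r ^ 2 * r ^ k) sums ((1 - \<alpha> ^ 2) * r ^ 2 * (1 / (1 - r)))"
      using r by (intro sums_mult geometric_sums) auto
    then show ?thesis by (simp add: mult_ac power2_eq_square)
  qed
  have "(\<Sum>k. cmod (a (k + 2)) * cmod z ^ (k + 2)) \<le> (\<Sum>k. (1 - \<alpha> ^ 2) * r ^ (k + 2))"
  proof (rule suminf_le[OF _ bohr_lhs_tail_summable[OF ps z] sums_summable[OF geo]])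
    show "cmod (a (k + 2)) * cmod z ^ (k + 2) \<le> (1 - \<alpha> ^ 2) * r ^ (k + 2)" for k
      using schur_class_coeff_bound[OF f ps, of "k + 2"]
      unfolding defs by (intro mult_right_mono) auto
  qed
  also have "\<dots> = (1 - \<alpha> ^ 2) * r ^ 2 / (1 - r)" using geo by (simp add: sums_iff)
  finally have "bohr_lhs m f a z \<le> v + c * (1 - v ^ 2) + (1 - \<alpha> ^ 2) * r ^ 2 / (1 - r)"
    using d mono by (simp add: bohr_lhs_def defs)
  also have "\<dots> \<le> 1"
    using Bohr_majorant_le_1[OF m, of \<alpha> r] \<alpha> r \<Phi> by (simp only: cv) (simp add: v_def defs)
  finally show ?thesis .
qed

section \<open>Sharpness through Moebius maps\<close>

lemma Moebius_has_power_series: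
  fixes \<alpha> :: real
  assumes "0 < \<alpha>" "\<alpha> < 1"
  shows "has_power_series (Moebius_function 0 (- of_real \<alpha>))
    (\<lambda>k. of_real (case k of 0 \<Rightarrow> \<alpha> | Suc j \<Rightarrow> (1 - \<alpha> ^ 2) * (- \<alpha>) ^ j))"
    (is "has_power_series _ ?a")
  unfolding has_power_series_def
proof
  fix z assume "z \<in> \<D>"
  then have z: "cmod z < 1" by (simp add: unit_disc_def)
  have nz: "1 + of_real \<alpha> * z \<noteq> 0"
    using one_minus_cnj_mult_nonzero[of "- of_real \<alpha>" z] z assms by simp
  have "cmod (- of_real \<alpha> * z) < 1"
    using norm_mult_less[of "of_real \<alpha> :: complex" 1 z 1] z assms by (simp add: norm_mult)
  \<comment> \<open>The expansion comes from (\<alpha> + z)/(1 + \<alpha> z) = \<alpha> + (1 -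
    \<alpha>^2) z/(1 + \<alpha> z), with a geometric series of ratio -\<alpha> z.\<close>
  then have "(\<lambda>j. of_real (1 - \<alpha> ^ 2) * z * (- of_real \<alpha> * z) ^ j)
      sums (of_real (1 - \<alpha> ^ 2) * z * (1 / (1 - (- of_real \<alpha> * z))))"
    by (intro sums_mult geometric_sums)
  moreover have "?a (Suc j) * z ^ Suc j = of_real (1 - \<alpha> ^ 2) * z * (- of_real \<alpha> * z) ^ j" for j
    by (simp only: nat.case of_real_mult of_real_power of_real_minus power_Suc
        power_mult_distrib mult_ac)
  ultimately have "(\<lambda>j. ?a (Suc j) * z ^ Suc j)
      sums (of_real (1 - \<alpha> ^ 2) * z * (1 / (1 - (- of_real \<alpha> * z))))"
    by (simp only:)
  then have "(\<lambda>k. ?a k * z ^ k)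
      sums (of_real (1 - \<alpha> ^ 2) * z * (1 / (1 - (- of_real \<alpha> * z))) + ?a 0 * z ^ 0)"
    by (rule sums_Suc)
  also have "of_real (1 - \<alpha> ^ 2) * z * (1 / (1 - (- of_real \<alpha> * z))) + ?a 0 * z ^ 0
      = Moebius_function 0 (- of_real \<alpha>) z"
    using nz by (simp add: Moebius_function_simple field_simps power2_eq_square)
  finally show "(\<lambda>k. ?a k * z ^ k) sums Moebius_function 0 (- of_real \<alpha>) z" .
qed

text \<open>At z = r this map attains both Schwarz-Pick bounds. Only the tail falls short of the
  majorant, through powers of \<alpha> that tend to 1 as \<alpha> does.\<close>

lemma bohr_lhs_Moebius:
  fixes \<alpha> r :: real and m :: nat
  assumes \<alpha>: "0 < \<alpha>" "\<alpha> < 1" and r: "0 \<le> r" "r < 1"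
  defines "\<rho> \<equiv> r ^ m"
  shows "bohr_lhs m (Moebius_function 0 (- of_real \<alpha>))
      (\<lambda>k. of_real (case k of 0 \<Rightarrow> \<alpha> | Suc j \<Rightarrow> (1 - \<alpha> ^ 2) * (- \<alpha>) ^ j)) (of_real r)
    = (\<alpha> + \<rho>) / (1 + \<alpha> * \<rho>) + r * (1 - \<alpha> ^ 2) / (1 + \<alpha> * \<rho>) ^ 2
      + (1 - \<alpha> ^ 2) * \<alpha> * r ^ 2 / (1 - \<alpha> * r)"
proof -
  have \<rho>: "0 \<le> \<rho>" using r by (simp add: \<rho>_def)
  have D: "0 < 1 + \<alpha> * \<rho>" using \<alpha> \<rho> by (simp add: add_pos_nonneg)
  have \<alpha>2: "\<alpha> ^ 2 \<le> 1" using \<alpha> by (simp add: power_le_one)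
  have zm: "(of_real r :: complex) ^ m = of_real \<rho>" by (simp add: \<rho>_def)
  have Dc: "1 + of_real \<alpha> * of_real \<rho> = (of_real (1 + \<alpha> * \<rho>) :: complex)" by simp
  then have nz: "1 + of_real \<alpha> * of_real \<rho> \<noteq> (0 :: complex)"
    using D by (simp del: of_real_add of_real_mult)
  have f: "Moebius_function 0 (- of_real \<alpha>) (of_real \<rho>) = of_real ((\<alpha> + \<rho>) / (1 + \<alpha> * \<rho>))"
    by (simp add: Moebius_function_simple add.commute)
  have "(Moebius_function 0 (- of_real \<alpha>) has_field_derivative
      of_real ((1 - \<alpha> ^ 2) / (1 + \<alpha> * \<rho>) ^ 2)) (at (of_real \<rho>))"
    using Moebius_function_has_field_derivative[of "- of_real \<alpha>" "of_real \<rho>"] nz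
    by (simp add: power2_eq_square)
  then have d: "deriv (Moebius_function 0 (- of_real \<alpha>)) (of_real \<rho>)
      = of_real ((1 - \<alpha> ^ 2) / (1 + \<alpha> * \<rho>) ^ 2)"
    by (rule DERIV_imp_deriv)
  have "\<alpha> * r < 1" using \<alpha> r mult_strict_mono[of \<alpha> 1 r 1] by simp
  then have "(\<lambda>k. (1 - \<alpha> ^ 2) * \<alpha> * r ^ 2 * (\<alpha> * r) ^ k)
      sums ((1 - \<alpha> ^ 2) * \<alpha> * r ^ 2 * (1 / (1 - \<alpha> * r)))"
    using \<alpha> r by (intro sums_mult geometric_sums) auto
  \<comment> \<open>Moduli remove the alternating signs. Index k + 2 means j = k + 1, hence one
    factor \<alpha> beyond the ratio's powers.\<close>
  moreover have "cmod (of_real (case k + 2 of 0 \<Rightarrow> \<alpha> | Suc j \<Rightarrow> (1 - \<alpha> ^ 2) * (- \<alpha>) ^ j))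
      * cmod (of_real r) ^ (k + 2) = (1 - \<alpha> ^ 2) * \<alpha> * r ^ 2 * (\<alpha> * r) ^ k" for k
    using \<alpha> r \<alpha>2
    by (simp only: norm_of_real)
       (simp add: abs_mult power_abs power_mult_distrib power2_eq_square)
  ultimately have "(\<Sum>k. cmod (of_real (case k + 2 of 0 \<Rightarrow> \<alpha> | Suc j \<Rightarrow> (1 - \<alpha> ^ 2) * (- \<alpha>) ^ j))
      * cmod (of_real r) ^ (k + 2)) = (1 - \<alpha> ^ 2) * \<alpha> * r ^ 2 / (1 - \<alpha> * r)"
    by (simp add: sums_iff)
  then show ?thesis
    unfolding bohr_lhs_def zm f d norm_of_real using \<alpha> r \<rho> D \<alpha>2 by simp
qed

lemma bohr_lhs_gt_1:
  assumes r: "0 \<le> r" "r < 1" and \<Phi>: "0 < \<Phi> m r"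
  shows "\<exists>f\<in>\<B>. \<exists>a. has_power_series f a \<and> bohr_lhs m f a (of_real r) > 1"
proof -
  define \<rho> where "\<rho> = r ^ m"
  have \<rho>: "0 \<le> \<rho>" using r by (simp add: \<rho>_def)
  \<comment> \<open>Again the excess over 1 without its factor 1 - t and its denominator, which is
    now (1 - t r)(1 + t \<rho>)^2. The excess itself vanishes at t = 1, so its sign just below 1 is
    read off from \<open>G 1\<close>.\<close>
  define G where "G t = r * (1 - t * r) * (1 + t) + t * r ^ 2 * (1 + t) * (1 + t * \<rho>) ^ 2
      - (1 - t * r) * (1 - \<rho>) * (1 + t * \<rho>)" for t
  have "G 1 = \<Phi> m r"
    by (simp add: G_def \<Phi>_def \<rho>_def[symmetric] power2_eq_square algebra_simps)
  moreover have "(G \<longlongrightarrow> G 1) (at_left 1)"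
    unfolding G_def by (intro tendsto_intros)
  ultimately have "eventually (\<lambda>t. 0 < G t) (at_left 1)"
    using \<Phi> order_tendstoD(1) by metis
  moreover have "eventually (\<lambda>t. t \<in> {0<..<1}) (at_left (1::real))"
    by (rule eventually_at_left_real) simp
  ultimately have "eventually (\<lambda>t. 0 < G t \<and> t \<in> {0<..<1}) (at_left 1)"
    by (rule eventually_conj)
  from eventually_happens'[OF _ this] obtain \<alpha> where \<alpha>: "0 < \<alpha>" "\<alpha> < 1" and G: "0 < G \<alpha>"
    by auto
  have "\<alpha> * r < 1" using \<alpha> r mult_strict_mono[of \<alpha> 1 r 1] by simp
  moreover define D E where "D = 1 + \<alpha> * \<rho>" "E = 1 - \<alpha> * r"
  ultimately have pos: "0 < D" "0 < E" using \<alpha> \<rho> by (auto simp: add_pos_nonneg)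
  have "(\<alpha> + \<rho>) / D + r * (1 - \<alpha> ^ 2) / D ^ 2 + (1 - \<alpha> ^ 2) * \<alpha> * r ^ 2 / E - 1
      = (1 - \<alpha>) * G \<alpha> / (E * D ^ 2)"
  proof -
    have "(\<alpha> + \<rho>) * D * E / (E * D ^ 2) = (\<alpha> + \<rho>) / D"
      "r * (1 - \<alpha> ^ 2) * E / (E * D ^ 2) = r * (1 - \<alpha> ^ 2) / D ^ 2"
      "(1 - \<alpha> ^ 2) * \<alpha> * r ^ 2 * D ^ 2 / (E * D ^ 2) = (1 - \<alpha> ^ 2) * \<alpha> * r ^ 2 / E"
      "E * D ^ 2 / (E * D ^ 2) = 1"
      using pos by (simp_all add: power2_eq_square)
    moreover have "(1 - \<alpha>) * G \<alpha> = (\<alpha> + \<rho>) * D * E + r * (1 - \<alpha> ^ 2) * E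
        + (1 - \<alpha> ^ 2) * \<alpha> * r ^ 2 * D ^ 2 - E * D ^ 2"
      by (simp add: G_def D_E_def power2_eq_square algebra_simps)
    ultimately show ?thesis by (simp only: add_divide_distrib diff_divide_distrib)
  qed
  also have "\<dots> > 0" using \<alpha> G pos by simp
  finally have gt: "1 < (\<alpha> + \<rho>) / D + r * (1 - \<alpha> ^ 2) / D ^ 2 + (1 - \<alpha> ^ 2) * \<alpha> * r ^ 2 / E"
    by simp
  have \<alpha>': "cmod (- of_real \<alpha>) < 1" using \<alpha> by simp
  have "Moebius_function 0 (- of_real \<alpha>) \<in> \<B>"
    using Moebius_function_holomorphic[OF \<alpha>'] Moebius_function_norm_lt_1[OF \<alpha>']
    by (auto simp: schur_class_def unit_disc_eq_ball)
  then show ?thesis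
    using Moebius_has_power_series[OF \<alpha>] bohr_lhs_Moebius[OF \<alpha> r, of m] gt
    unfolding \<rho>_def[symmetric] D_E_def[symmetric]
    by (intro bexI[of _ "Moebius_function 0 (- of_real \<alpha>)"] exI conjI) auto
qed

theorem theorem4:
  fixes m :: nat
  assumes "1 \<le> m"
  shows "(\<forall>f\<in>\<B>. \<forall>a. has_power_series f a \<longrightarrow>
            (\<forall>z\<in>\<D>. cmod z \<le> R3 m \<longrightarrow> bohr_lhs m f a z \<le> 1))
       \<and> (\<forall>R'. R3 m < R' \<and> R' < 1 \<longrightarrow>
            (\<exists>f\<in>\<B>. \<exists>a z. has_power_series f a \<and> cmod z \<le> R' \<and> bohr_lhs m f a z > 1))"
proof (intro conjI ballI allI impI)
  fix f a z
  assume f: "f \<in> \<B>" "has_power_series f a" and z: "z \<in> \<D>" "cmod z \<le> R3 m"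
  \<comment> \<open>Strict monotonicity makes \<open>R3 m\<close> the single sign change of \<Phi>
    on the nonnegative axis.\<close>
  have "\<Phi> m (cmod z) \<le> 0"
    using \<Phi>_strict_mono[OF assms, of "cmod z" "R3 m"] R3_root(2)[OF assms] z(2)
    by (cases "cmod z = R3 m") auto
  then show "bohr_lhs m f a z \<le> 1" using bohr_lhs_le_1[OF assms f z(1)] by simp
next
  fix R' assume R': "R3 m < R' \<and> R' < 1"
  then have "0 < \<Phi> m R'" "0 \<le> R'"
    using \<Phi>_strict_mono[OF assms, of "R3 m" R'] R3_root(1,2)[OF assms] by auto
  \<comment> \<open>The violating point is z = R' itself, where \<Phi> is already positive.\<close>
  moreover from this have "cmod (of_real R') \<le> R'" by simp
  ultimately show "\<exists>f\<in>\<B>. \<exists>a z. has_power_series f a \<and> cmod z \<le> R' \<and> bohr_lhs m f a z > 1"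
    using bohr_lhs_gt_1[of R' m] R' by blast
qed

end
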